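(* Let $X$ be a nonnegative real-valued random variable (not necessarily integrable) and let $U\sim\mathrm{Unif}(0,1)$ be independent of $X$. Then for any $a>0$, $$P(X\ge U/a)=\mathbb E[\min(aX,1)]\le a\,\mathbb E[X].$$ Further, if $U$ is instead any random variable independent of $X$ that is stochastically larger than uniform, then the first equality becomes an inequality: $P(X\ge U/a)\le \mathbb E[\min(aX,1)]$. Last, if $X\in[0,C]$ almost surely for some constant $C>0$ (and $U\sim\mathrm{Unif}(0,1)$), then $P(X\ge U/a)= a\,\mathbb E[X]$ for any $0<a\le 1/C$.
   Context: A random variable $U$ is stochastically larger than uniform (on $[0,1]$) if $P(U\le u)\le u$ for all $u\in[0,1]$. If $X$ is nonintegrable, $\mathbb E[X]=+\infty$. *)

theory Defs
  imports "HOL-Probability.Probability"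
begin

definition uniform_01 :: "'a measure \<Rightarrow> ('a \<Rightarrow> real) \<Rightarrow> bool" where
  "uniform_01 M U \<longleftrightarrow>
     U \<in> borel_measurable M \<and> distr M borel U = uniform_measure lborel {0<..<1}"

definition stochastically_larger_than_uniform :: "'a measure \<Rightarrow> ('a \<Rightarrow> real) \<Rightarrow> bool" where
  "stochastically_larger_than_uniform M U \<longleftrightarrow>
     U \<in> borel_measurable M \<and> (\<forall>u\<in>{0..1}. measure M {\<omega> \<in> space M. U \<omega> \<le> u} \<le> u)"

text \<open>The Bochner integral of a non-integrable function is \<open>0\<close>, so expectations of nonnegative
  random variables are taken as nonnegative Lebesgue integrals, with value \<open>\<infinity>\<close> in that case.
  Negative values of \<open>Y\<close> are truncated to \<open>0\<close>; use only for almost surely nonnegative \<open>Y\<close>.\<close>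

definition nn_expectation :: "'a measure \<Rightarrow> ('a \<Rightarrow> real) \<Rightarrow> ennreal" where
  "nn_expectation M Y = (\<integral>\<^sup>+\<omega>. ennreal (Y \<omega>) \<partial>M)"

end

theory Submission
  imports Defs
begin

text \<open>Conditioning on \<open>X\<close> (Fubini for the product of the two laws) gives
  \<open>P(U \<le> Y) = E[F(Y)]\<close> for \<open>Y = a X\<close>, where \<open>F\<close> is the distribution function of \<open>U\<close>. For uniform
  \<open>U\<close>, \<open>F(x)\<close> is the positive part of \<open>min x 1\<close>, and it is at most this for \<open>U\<close> stochastically
  larger than uniform.\<close>

lemma (in prob_space) indep_var_emeasure_le:
  fixes X U :: "'a \<Rightarrow> real"
  assumes "indep_var borel X borel U" and [measurable]: "f \<in> borel_measurable borel"
  shows "emeasure M {\<omega> \<in> space M. U \<omega> \<le> f (X \<omega>)}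
       = (\<integral>\<^sup>+\<omega>. emeasure (distr M borel U) {..f (X \<omega>)} \<partial>M)"
proof -
  have [measurable]: "X \<in> borel_measurable M" "U \<in> borel_measurable M"
    and joint: "distr M borel X \<Otimes>\<^sub>M distr M borel U = distr M (borel \<Otimes>\<^sub>M borel) (\<lambda>\<omega>. (X \<omega>, U \<omega>))"
    using assms(1) unfolding indep_var_distribution_eq by auto
  interpret U: prob_space "distr M borel U" by (rule prob_space_distr) simp
  \<comment> \<open>The event is the preimage under \<open>(X, U)\<close> of the region on or below
    the graph of \<open>f\<close>. Each vertical slice of this region is a half-line, so its mass
    under the law of \<open>U\<close> is a value of the distribution function.\<close>
  define A :: "(real \<times> real) set" where "A = {p. snd p \<le> f (fst p)}"
  have "{p \<in> space (borel \<Otimes>\<^sub>M borel). snd p \<le> f (fst p)} \<in> sets (borel \<Otimes>\<^sub>M borel)"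
    by measurable
  then have A [measurable]: "A \<in> sets (borel \<Otimes>\<^sub>M borel)"
    by (simp add: A_def space_pair_measure)
  have slice: "Pair x -` A = {..f x}" for x
    by (auto simp: A_def)
  \<comment> \<open>Measurability of slice masses is what allows the integral over the law of
    \<open>X\<close> to be pulled back to \<open>M\<close> at the end.\<close>
  have "(\<lambda>x. emeasure (distr M borel U) (Pair x -` A)) \<in> borel_measurable borel"
    by (rule U.measurable_emeasure_Pair) simp
  then have [measurable]: "(\<lambda>x. emeasure (distr M borel U) {..f x}) \<in> borel_measurable borel"
    by (simp add: slice)
  have "emeasure M {\<omega> \<in> space M. U \<omega> \<le> f (X \<omega>)}
      = emeasure (distr M (borel \<Otimes>\<^sub>M borel) (\<lambda>\<omega>. (X \<omega>, U \<omega>))) A"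
    by (subst emeasure_distr) (auto simp: A_def[symmetric] intro!: arg_cong2[where f=emeasure], auto simp: A_def)
  also have "\<dots> = (\<integral>\<^sup>+x. emeasure (distr M borel U) (Pair x -` A) \<partial>distr M borel X)"
    unfolding joint[symmetric] by (rule U.emeasure_pair_measure_alt) simp
  also have "\<dots> = (\<integral>\<^sup>+\<omega>. emeasure (distr M borel U) {..f (X \<omega>)} \<partial>M)"
    unfolding slice by (rule nn_integral_distr) simp_all
  finally show ?thesis .
qed

text \<open>Since \<open>ennreal\<close> sends negative reals to 0, truncating at 1 from above
  already gives the right value for every real \<open>x\<close>, negative ones included.\<close>

lemma emeasure_uniform_01_atMost:
  "emeasure (uniform_measure lborel {0<..<1}) {..x} = ennreal (min x 1)" for x :: real
proof -
  have "emeasure lborel ({0<..<1} \<inter> {..x}) = ennreal (min x 1)"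
  proof -
    consider "x \<le> 0" | "0 < x" "x < 1" | "1 \<le> x" by linarith
    then show ?thesis
    proof cases
      case 1
      then have "{0<..<1} \<inter> {..x} = {}" by auto
      with 1 show ?thesis by (simp add: ennreal_neg)
    next
      case 2
      then have "{0<..<1} \<inter> {..x} = {0<..x}" by auto
      with 2 show ?thesis by simp
    next
      case 3
      then have "{0<..<1} \<inter> {..x} = {0<..<1}" by auto
      with 3 show ?thesis by simp
    qed
  qed
  then show ?thesis by (simp add: divide_ennreal_def)
qed

text \<open>Extends the bound from [0,1], where the definition states it, to the whole line, because
  the values of \<open>a * X\<close> may leave [0,1].\<close>

lemma (in prob_space) stochastically_larger_than_uniform_cdf_le:
  assumes "stochastically_larger_than_uniform M U"
  shows "emeasure (distr M borel U) {..x} \<le> ennreal (min x 1)"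
proof -
  have [measurable]: "U \<in> borel_measurable M"
    using assms by (simp add: stochastically_larger_than_uniform_def)
  have le: "prob {\<omega> \<in> space M. U \<omega> \<le> u} \<le> u" if "0 \<le> u" "u \<le> 1" for u
    using assms that by (simp add: stochastically_larger_than_uniform_def)
  \<comment> \<open>Clamp \<open>x\<close> to [0,1]. If \<open>x \<le> 1\<close>, then
    \<open>x \<le> u\<close> and monotonicity applies; for negative \<open>x\<close> this forces
    mass 0. If \<open>x > 1\<close>, then \<open>u = 1\<close> and the bound is trivial.\<close>
  define u where "u = max 0 (min x 1)"
  have "prob {\<omega> \<in> space M. U \<omega> \<le> x} \<le> u"
  proof (cases "x \<le> 1")
    case True
    have "prob {\<omega> \<in> space M. U \<omega> \<le> x} \<le> prob {\<omega> \<in> space M. U \<omega> \<le> u}"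
      using True by (intro finite_measure_mono) (auto simp: u_def)
    also have "\<dots> \<le> u"
      by (rule le) (auto simp: u_def)
    finally show ?thesis .
  qed (simp add: u_def)
  moreover have "emeasure (distr M borel U) {..x} = ennreal (prob {\<omega> \<in> space M. U \<omega> \<le> x})"
    by (subst emeasure_distr)
      (auto simp: emeasure_eq_measure intro!: arg_cong[where f=prob])
  ultimately show ?thesis
    by (simp add: u_def ennreal_leI max_def ennreal_neg split: if_splits)
qed

theorem theorem1p2:
  fixes M :: "'a measure" and X U :: "'a \<Rightarrow> real"
  assumes "prob_space M"
    and "X \<in> borel_measurable M"
    and "AE \<omega> in M. 0 \<le> X \<omega>"
    and "prob_space.indep_var M borel X borel U"
  shows
    "(uniform_01 M U \<longrightarrow>
        (\<forall>a>0. ennreal (measure M {\<omega> \<in> space M. X \<omega> \<ge> U \<omega> / a})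
                 = nn_expectation M (\<lambda>\<omega>. min (a * X \<omega>) 1)
             \<and> nn_expectation M (\<lambda>\<omega>. min (a * X \<omega>) 1) \<le> ennreal a * nn_expectation M X))
   \<and> (stochastically_larger_than_uniform M U \<longrightarrow>
        (\<forall>a>0. ennreal (measure M {\<omega> \<in> space M. X \<omega> \<ge> U \<omega> / a})
                 \<le> nn_expectation M (\<lambda>\<omega>. min (a * X \<omega>) 1)))
   \<and> (uniform_01 M U \<longrightarrow>
        (\<forall>C>0. (AE \<omega> in M. X \<omega> \<in> {0..C}) \<longrightarrow>
          (\<forall>a. 0 < a \<and> a \<le> 1 / C \<longrightarrow>
             ennreal (measure M {\<omega> \<in> space M. X \<omega> \<ge> U \<omega> / a})
               = ennreal a * nn_expectation M X)))"
proof -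
  interpret prob_space M by fact
  \<comment> \<open>As \<open>a > 0\<close>, the event is \<open>U \<le> a * X\<close>.\<close>
  have prob_eq: "ennreal (prob {\<omega> \<in> space M. X \<omega> \<ge> U \<omega> / a})
      = (\<integral>\<^sup>+\<omega>. emeasure (distr M borel U) {..a * X \<omega>} \<partial>M)" if "0 < a" for a
    using indep_var_emeasure_le[OF assms(4), of "\<lambda>x. a * x"] that
    by (simp add: emeasure_eq_measure divide_le_eq mult.commute)
  have unif: "ennreal (prob {\<omega> \<in> space M. X \<omega> \<ge> U \<omega> / a})
      = nn_expectation M (\<lambda>\<omega>. min (a * X \<omega>) 1)" if "uniform_01 M U" "0 < a" for a
    using that by (simp add: prob_eq uniform_01_def emeasure_uniform_01_atMost nn_expectation_def)
  have larger: "ennreal (prob {\<omega> \<in> space M. X \<omega> \<ge> U \<omega> / a})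
      \<le> nn_expectation M (\<lambda>\<omega>. min (a * X \<omega>) 1)"
    if "stochastically_larger_than_uniform M U" "0 < a" for a
    unfolding prob_eq[OF that(2)] nn_expectation_def
    by (intro nn_integral_mono stochastically_larger_than_uniform_cdf_le that)
  \<comment> \<open>Working in \<open>ennreal\<close> keeps this valid when the expectation of
    \<open>X\<close> is infinite.\<close>
  have scale: "ennreal a * nn_expectation M X = nn_expectation M (\<lambda>\<omega>. a * X \<omega>)" if "0 < a" for a
    using that assms(2) by (simp add: nn_expectation_def ennreal_mult' nn_integral_cmult)
  have markov: "nn_expectation M (\<lambda>\<omega>. min (a * X \<omega>) 1) \<le> ennreal a * nn_expectation M X"
    if "0 < a" for a
    unfolding scale[OF that] unfolding nn_expectation_def by (intro nn_integral_mono ennreal_leI) simp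
  have bounded: "nn_expectation M (\<lambda>\<omega>. min (a * X \<omega>) 1) = ennreal a * nn_expectation M X"
    if "0 < C" "AE \<omega> in M. X \<omega> \<in> {0..C}" "0 < a" "a \<le> 1 / C" for a C
  proof -
    \<comment> \<open>Almost surely \<open>a * X\<close> is at most \<open>1 / C * C = 1\<close>, so
      the truncation at 1 has no effect.\<close>
    have "AE \<omega> in M. ennreal (min (a * X \<omega>) 1) = ennreal (a * X \<omega>)"
      using that(2)
    proof eventually_elim
      case (elim \<omega>)
      then have "a * X \<omega> \<le> 1 / C * C"
        using that by (intro mult_mono) auto
      with that show ?case by simp
    qed
    then show ?thesis
      unfolding scale[OF that(3)] unfolding nn_expectation_def by (rule nn_integral_cong_AE)
  qed
  show ?thesis
    by (intro conjI impI allI) (simp_all add: unif larger markov bounded)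
qed

end
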